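(* The principal 3D slice $\mathcal{T}(\mathbf{i_1},\mathbf{j_1},\mathbf{j_2})$ of the tricomplex Mandelbrot set (the Hourglassbrot) satisfies $$\mathcal{T}(\mathbf{i_1},\mathbf{j_1},\mathbf{j_2}) = \mathcal{T}^{\ast}(1,\mathbf{i_1},\mathbf{j_1})\cap\mathcal{T}^{\ast}(-1,\mathbf{i_1},\mathbf{j_1}),$$ where $$\mathcal{T}^{\ast}(1,\mathbf{i_1},\mathbf{j_1}) := \{c_2\mathbf{i_1}+c_4\mathbf{j_1}+c_6\mathbf{j_2}: c_2,c_4,c_6\in\mathbb{R},\ c_2\mathbf{i_1}+c_4\mathbf{j_1}+c_6 \in \mathcal{T}(1,\mathbf{i_1},\mathbf{j_1})\}$$ and $$\mathcal{T}^{\ast}(-1,\mathbf{i_1},\mathbf{j_1}) := \{c_2\mathbf{i_1}+c_4\mathbf{j_1}+c_6\mathbf{j_2}: c_2,c_4,c_6\in\mathbb{R},\ c_2\mathbf{i_1}+c_4\mathbf{j_1}-c_6 \in \mathcal{T}(1,\mathbf{i_1},\mathbf{j_1})\}.$$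
   Context: The tricomplex numbers $\mathbb{TC}$ form the commutative, associative unital real algebra generated by three commuting elements $\mathbf{i_1},\mathbf{i_2},\mathbf{i_3}$ with $\mathbf{i_1}^2=\mathbf{i_2}^2=\mathbf{i_3}^2=-1$; it has dimension 8 over $\mathbb{R}$ with basis $1,\mathbf{i_1},\mathbf{i_2},\mathbf{j_1},\mathbf{i_3},\mathbf{j_2},\mathbf{j_3},\mathbf{i_4}$, where $\mathbf{j_1}=\mathbf{i_1}\mathbf{i_2}$, $\mathbf{j_2}=\mathbf{i_1}\mathbf{i_3}$, $\mathbf{j_3}=\mathbf{i_2}\mathbf{i_3}$ and $\mathbf{i_4}=\mathbf{i_1}\mathbf{i_2}\mathbf{i_3}$. Boundedness in $\mathbb{TC}\cong\mathbb{R}^8$ is with respect to the Euclidean norm. For $c\in\mathbb{TC}$ let $P_c(\eta)=\eta^2+c$ and let $P_c^{(n)}$ be its $n$-fold composition. The tricomplex Mandelbrot set is $\mathcal{M}_3=\{c\in\mathbb{TC}:\{P_c^{(n)}(0)\}_{n\in\mathbb{N}}\text{ is bounded}\}$. For three distinct units $\mathbf{u},\mathbf{v},\mathbf{w}\in\{1,\mathbf{i_1},\mathbf{i_2},\mathbf{j_1},\mathbf{i_3},\mathbf{j_2},\mathbf{j_3},\mathbf{i_4}\}$, the principal 3D slice is $\mathcal{T}(\mathbf{u},\mathbf{v},\mathbf{w})=\mathrm{span}_{\mathbb{R}}\{\mathbf{u},\mathbf{v},\mathbf{w}\}\cap\mathcal{M}_3$. *)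

theory Defs
  imports "HOL-Analysis.Analysis"
begin

text \<open>
  The tricomplex numbers are built from the complex numbers by adjoining, twice in succession, a
  new square root of \<open>-1\<close> that commutes with everything. For a commutative ring \<open>R\<close>,
  \<open>Adj a b\<close> stands for \<open>a + b \<iota>\<close> in \<open>R[\<iota>]/(\<iota>\<^sup>2 + 1)\<close>.
\<close>

datatype 'a adj = Adj (adj1: 'a) (adj2: 'a)

lemma adj_eq_iff: "x = y \<longleftrightarrow> adj1 x = adj1 y \<and> adj2 x = adj2 y"
  by (cases x; cases y) simp

instantiation adj :: (comm_ring_1) comm_ring_1
begin

definition "0 = Adj 0 0"
definition "1 = Adj 1 0"
definition "x + y = Adj (adj1 x + adj1 y) (adj2 x + adj2 y)"
definition "- x = Adj (- adj1 x) (- adj2 x)"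
definition "x - y = Adj (adj1 x - adj1 y) (adj2 x - adj2 y)"
definition "x * y = Adj (adj1 x * adj1 y - adj2 x * adj2 y) (adj1 x * adj2 y + adj2 x * adj1 y)"

instance
  by standard
    (simp_all add: adj_eq_iff zero_adj_def one_adj_def plus_adj_def uminus_adj_def minus_adj_def
      times_adj_def algebra_simps)

end

lemma adj_sel [simp]:
  "adj1 0 = 0" "adj2 0 = 0" "adj1 1 = 1" "adj2 1 = 0"
  "adj1 (x + y) = adj1 x + adj1 y" "adj2 (x + y) = adj2 x + adj2 y"
  "adj1 (- x) = - adj1 x" "adj2 (- x) = - adj2 x"
  "adj1 (x - y) = adj1 x - adj1 y" "adj2 (x - y) = adj2 x - adj2 y"
  "adj1 (x * y) = adj1 x * adj1 y - adj2 x * adj2 y"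
  "adj2 (x * y) = adj1 x * adj2 y + adj2 x * adj1 y"
  by (simp_all add: zero_adj_def one_adj_def plus_adj_def uminus_adj_def minus_adj_def
      times_adj_def)

instantiation adj :: ("{comm_ring_1, real_algebra_1}") real_algebra_1
begin

definition "scaleR r x = Adj (r *\<^sub>R adj1 x) (r *\<^sub>R adj2 x)"

instance
  by standard (simp_all add: adj_eq_iff scaleR_adj_def algebra_simps)

end

lemma adj_sel_scaleR [simp]:
  "adj1 (r *\<^sub>R x) = r *\<^sub>R adj1 x" "adj2 (r *\<^sub>R x) = r *\<^sub>R adj2 x"
  by (simp_all add: scaleR_adj_def)

text \<open>
  The norm is the Euclidean norm of the direct sum. Already for the bicomplex numbers
  \<open>complex adj\<close> it is not submultiplicative, so there is no instance of \<open>real_normed_algebra\<close>.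
\<close>

instantiation adj :: ("{comm_ring_1, real_algebra_1, real_inner}") real_inner
begin

definition "inner x y = inner (adj1 x) (adj1 y) + inner (adj2 x) (adj2 y)"
definition "norm (x :: 'a adj) = sqrt (inner x x)"
definition "sgn (x :: 'a adj) = x /\<^sub>R norm x"
definition "dist x (y :: 'a adj) = norm (x - y)"
definition [code del]:
  "(uniformity :: ('a adj \<times> 'a adj) filter) = (INF e\<in>{0 <..}. principal {(x, y). dist x y < e})"
definition open_adj_def [code del]:
  "open (U :: 'a adj set) \<longleftrightarrow>
    (\<forall>x\<in>U. eventually (\<lambda>(x', y). x' = x \<longrightarrow> y \<in> U) uniformity)"

instance
proof
  fix x y z :: "'a adj" and r :: real and U :: "'a adj set"
  show "dist x y = norm (x - y)" by (rule dist_adj_def)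
  show "sgn x = x /\<^sub>R norm x" by (rule sgn_adj_def)
  show "(uniformity :: ('a adj \<times> 'a adj) filter)
      = (INF e\<in>{0 <..}. principal {(x, y). dist x y < e})"
    by (rule uniformity_adj_def)
  show "open U \<longleftrightarrow> (\<forall>x\<in>U. eventually (\<lambda>(x', y). x' = x \<longrightarrow> y \<in> U) uniformity)"
    by (rule open_adj_def)
  show "inner x y = inner y x" by (simp add: inner_adj_def inner_commute)
  show "inner (x + y) z = inner x z + inner y z" by (simp add: inner_adj_def inner_add_left)
  show "inner (r *\<^sub>R x) y = r * inner x y" by (simp add: inner_adj_def algebra_simps)
  show "0 \<le> inner x x" by (simp add: inner_adj_def)
  show "inner x x = 0 \<longleftrightarrow> x = 0"
    by (simp add: inner_adj_def adj_eq_iff add_nonneg_eq_0_iff)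
  show "norm x = sqrt (inner x x)" by (rule norm_adj_def)
qed

end

type_synonym tricomplex = "complex adj adj"

definition tc_i1 :: tricomplex (\<open>\<i>\<^sub>1\<close>) where "\<i>\<^sub>1 = Adj (Adj \<i> 0) 0"
definition tc_i2 :: tricomplex (\<open>\<i>\<^sub>2\<close>) where "\<i>\<^sub>2 = Adj (Adj 0 1) 0"
definition tc_i3 :: tricomplex (\<open>\<i>\<^sub>3\<close>) where "\<i>\<^sub>3 = Adj 0 1"
definition tc_j1 :: tricomplex (\<open>\<j>\<^sub>1\<close>) where "\<j>\<^sub>1 = \<i>\<^sub>1 * \<i>\<^sub>2"
definition tc_j2 :: tricomplex (\<open>\<j>\<^sub>2\<close>) where "\<j>\<^sub>2 = \<i>\<^sub>1 * \<i>\<^sub>3"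
definition tc_j3 :: tricomplex (\<open>\<j>\<^sub>3\<close>) where "\<j>\<^sub>3 = \<i>\<^sub>2 * \<i>\<^sub>3"
definition tc_i4 :: tricomplex (\<open>\<i>\<^sub>4\<close>) where "\<i>\<^sub>4 = \<i>\<^sub>1 * \<i>\<^sub>2 * \<i>\<^sub>3"

lemmas tc_unit_defs = tc_i1_def tc_i2_def tc_i3_def tc_j1_def tc_j2_def tc_j3_def tc_i4_def

lemma tc_generators_squared: "\<i>\<^sub>1\<^sup>2 = -1" "\<i>\<^sub>2\<^sup>2 = -1" "\<i>\<^sub>3\<^sup>2 = -1"
  by (simp_all add: tc_unit_defs power2_eq_square adj_eq_iff)

text \<open>
  The next two facts say that \<open>1, \<i>\<^sub>1, \<i>\<^sub>2, \<j>\<^sub>1, \<i>\<^sub>3, \<j>\<^sub>2, \<j>\<^sub>3, \<i>\<^sub>4\<close> is a real basis and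
  that the norm is the Euclidean one in the corresponding coordinates.
\<close>

lemma tricomplex_coordinates:
  fixes \<eta> :: tricomplex
  obtains x1 x2 x3 x4 x5 x6 x7 x8 :: real where
    "\<eta> = x1 *\<^sub>R 1 + x2 *\<^sub>R \<i>\<^sub>1 + x3 *\<^sub>R \<i>\<^sub>2 + x4 *\<^sub>R \<j>\<^sub>1
       + x5 *\<^sub>R \<i>\<^sub>3 + x6 *\<^sub>R \<j>\<^sub>2 + x7 *\<^sub>R \<j>\<^sub>3 + x8 *\<^sub>R \<i>\<^sub>4"
proof
  show "\<eta> = Re (adj1 (adj1 \<eta>)) *\<^sub>R 1 + Im (adj1 (adj1 \<eta>)) *\<^sub>R \<i>\<^sub>1
       + Re (adj2 (adj1 \<eta>)) *\<^sub>R \<i>\<^sub>2 + Im (adj2 (adj1 \<eta>)) *\<^sub>R \<j>\<^sub>1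
       + Re (adj1 (adj2 \<eta>)) *\<^sub>R \<i>\<^sub>3 + Im (adj1 (adj2 \<eta>)) *\<^sub>R \<j>\<^sub>2
       + Re (adj2 (adj2 \<eta>)) *\<^sub>R \<j>\<^sub>3 + Im (adj2 (adj2 \<eta>)) *\<^sub>R \<i>\<^sub>4"
    by (simp add: tc_unit_defs adj_eq_iff complex_eq_iff)
qed

lemma tricomplex_norm:
  "norm (x1 *\<^sub>R 1 + x2 *\<^sub>R \<i>\<^sub>1 + x3 *\<^sub>R \<i>\<^sub>2 + x4 *\<^sub>R \<j>\<^sub>1
       + x5 *\<^sub>R \<i>\<^sub>3 + x6 *\<^sub>R \<j>\<^sub>2 + x7 *\<^sub>R \<j>\<^sub>3 + x8 *\<^sub>R \<i>\<^sub>4)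
    = sqrt (x1\<^sup>2 + x2\<^sup>2 + x3\<^sup>2 + x4\<^sup>2 + x5\<^sup>2 + x6\<^sup>2 + x7\<^sup>2 + x8\<^sup>2)"
  by (simp add: norm_adj_def inner_adj_def inner_complex_def tc_unit_defs power2_eq_square)

definition quad_poly :: "tricomplex \<Rightarrow> tricomplex \<Rightarrow> tricomplex" where
  "quad_poly c \<eta> = \<eta>\<^sup>2 + c"

definition Mandelbrot3 :: "tricomplex set" (\<open>\<M>\<^sub>3\<close>) where
  "\<M>\<^sub>3 = {c. bounded (range (\<lambda>n. (quad_poly c ^^ n) 0))}"

definition principal_slice :: "tricomplex \<Rightarrow> tricomplex \<Rightarrow> tricomplex \<Rightarrow> tricomplex set" (\<open>\<T>\<close>)
  where "\<T> u v w = span {u, v, w} \<inter> \<M>\<^sub>3"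

text \<open>
  Here \<open>c6\<close> is the coefficient of \<open>\<j>\<^sub>2\<close> on the left of the bar, but the (plus or minus) real part
  of the point tested for membership in \<open>\<T> 1 \<i>\<^sub>1 \<j>\<^sub>1\<close>.
\<close>

definition slice_star_pos :: "tricomplex set" where
  "slice_star_pos = {c2 *\<^sub>R \<i>\<^sub>1 + c4 *\<^sub>R \<j>\<^sub>1 + c6 *\<^sub>R \<j>\<^sub>2 | c2 c4 c6 :: real.
     c2 *\<^sub>R \<i>\<^sub>1 + c4 *\<^sub>R \<j>\<^sub>1 + of_real c6 \<in> \<T> 1 \<i>\<^sub>1 \<j>\<^sub>1}"

definition slice_star_neg :: "tricomplex set" where
  "slice_star_neg = {c2 *\<^sub>R \<i>\<^sub>1 + c4 *\<^sub>R \<j>\<^sub>1 + c6 *\<^sub>R \<j>\<^sub>2 | c2 c4 c6 :: real.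
     c2 *\<^sub>R \<i>\<^sub>1 + c4 *\<^sub>R \<j>\<^sub>1 - of_real c6 \<in> \<T> 1 \<i>\<^sub>1 \<j>\<^sub>1}"

end

theory Submission imports Defs begin

text \<open>
  A tricomplex number is \<open>a + b \<i>\<^sub>3\<close> with bicomplex \<open>a\<close> and \<open>b\<close>. Replacing \<open>\<i>\<^sub>3\<close> by one of the
  two bicomplex square roots \<open>-\<i>\<^sub>1\<close>, \<open>\<i>\<^sub>1\<close> of \<open>-1\<close> is a ring homomorphism onto the bicomplex
  numbers, and together these two evaluations decompose the tricomplex numbers as a product of two
  copies of the bicomplex numbers (the idempotents being \<open>(1 + \<j>\<^sub>2) / 2\<close> and \<open>(1 - \<j>\<^sub>2) / 2\<close>).
  Since they are homomorphisms, they carry the critical orbit of \<open>c\<close> to the critical orbits of the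
  two images of \<open>c\<close> (\<open>adj_eval_quad_poly_orbit\<close>); since the squared norm is the mean of
  the squared norms of the two images (\<open>norm_adj_eval_sum\<close>), an orbit is bounded iff both
  image orbits are. So \<open>c\<close> lies in \<open>\<M>\<^sub>3\<close> iff both images do (\<open>Mandelbrot3_iff_adj_eval\<close>).

  The evaluations fix \<open>\<i>\<^sub>1\<close> and \<open>\<j>\<^sub>1\<close> and send \<open>\<j>\<^sub>2 = \<i>\<^sub>1 \<i>\<^sub>3\<close> to \<open>1\<close> and \<open>-1\<close>. Hence the images
  of \<open>c2 \<i>\<^sub>1 + c4 \<j>\<^sub>1 + c6 \<j>\<^sub>2\<close> are exactly the points
  \<open>c2 \<i>\<^sub>1 + c4 \<j>\<^sub>1 \<plusminus> c6\<close> tested in the definitions of the two starred slices.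
\<close>

text \<open>
  The value is embedded back as an element without \<open>\<iota>\<close>-part, so that the image of a tricomplex
  number is again tricomplex and can be tested for membership in \<open>\<M>\<^sub>3\<close>.
\<close>

definition adj_eval :: "'a::comm_ring_1 \<Rightarrow> 'a adj \<Rightarrow> 'a adj" where
  "adj_eval w x = Adj (adj1 x + w * adj2 x) 0"

lemma adj_eval_0 [simp]: "adj_eval w 0 = 0"
  by (simp add: adj_eval_def adj_eq_iff)

lemma adj_eval_add: "adj_eval w (x + y) = adj_eval w x + adj_eval w y"
  by (simp add: adj_eval_def adj_eq_iff algebra_simps)

lemma adj_eval_mult:
  assumes "w * w = -1"
  shows "adj_eval w (x * y) = adj_eval w x * adj_eval w y"
proof -
  have w: "w * (w * z) = - z" for z
    using assms by (simp flip: mult.assoc)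
  show ?thesis
    by (simp add: adj_eval_def adj_eq_iff w algebra_simps)
qed

lemma adj_eval_quad_poly_orbit:
  assumes "w * w = -1"
  shows "adj_eval w ((quad_poly c ^^ n) 0) = (quad_poly (adj_eval w c) ^^ n) 0"
  by (induction n)
    (simp_all add: quad_poly_def power2_eq_square adj_eval_add adj_eval_mult assms)

text \<open>
  This is the parallelogram law for \<open>a\<close> and \<open>w b\<close>, where \<open>x = a + b \<iota>\<close>: multiplication by \<open>w\<close>
  being isometric, \<open>w b\<close> contributes the norm of \<open>b\<close>.
\<close>

lemma norm_adj_eval_sum:
  fixes x :: "'a::{comm_ring_1, real_algebra_1, real_inner} adj"
  assumes isometry: "\<And>y. norm (w * y) = norm y"
  shows "(norm (adj_eval w x))\<^sup>2 + (norm (adj_eval (- w) x))\<^sup>2 = 2 * (norm x)\<^sup>2"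
proof -
  have sq: "(norm y)\<^sup>2 = (norm (adj1 y))\<^sup>2 + (norm (adj2 y))\<^sup>2" for y :: "'a adj"
    by (simp add: power2_norm_eq_inner inner_adj_def)
  have "(norm (adj_eval w x))\<^sup>2 + (norm (adj_eval (- w) x))\<^sup>2
      = (norm (adj1 x + w * adj2 x))\<^sup>2 + (norm (adj1 x - w * adj2 x))\<^sup>2"
    unfolding sq by (simp add: adj_eval_def)
  also have "\<dots> = 2 * ((norm (adj1 x))\<^sup>2 + (norm (w * adj2 x))\<^sup>2)"
    by (simp add: power2_norm_eq_inner inner_simps inner_commute)
  finally show ?thesis
    by (simp add: isometry sq)
qed

text \<open>
  By the norm identity each image is at most \<open>2\<close> times as long as \<open>x\<close>, and \<open>x\<close> is at most as
  long as its two images together.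
\<close>

lemma bounded_iff_adj_eval:
  fixes f :: "'b \<Rightarrow> 'a::{comm_ring_1, real_algebra_1, real_inner} adj"
  assumes isometry: "\<And>y. norm (w * y) = norm y"
  shows "bounded (range f) \<longleftrightarrow>
    bounded (range (\<lambda>n. adj_eval w (f n))) \<and> bounded (range (\<lambda>n. adj_eval (- w) (f n)))"
    (is "?L \<longleftrightarrow> ?P \<and> ?N")
proof -
  have sum: "(norm (adj_eval w x))\<^sup>2 + (norm (adj_eval (- w) x))\<^sup>2 = 2 * (norm x)\<^sup>2"
    for x :: "'a adj"
    using isometry by (rule norm_adj_eval_sum)
  have le: "norm (adj_eval w x) \<le> 2 * norm x" "norm (adj_eval (- w) x) \<le> 2 * norm x"
    for x :: "'a adj"
  proof -
    have "0 \<le> (norm (adj_eval w x))\<^sup>2" "0 \<le> (norm (adj_eval (- w) x))\<^sup>2" "0 \<le> (norm x)\<^sup>2"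
      by simp_all
    with sum[of x] have sq: "(norm (adj_eval w x))\<^sup>2 \<le> (2 * norm x)\<^sup>2"
        "(norm (adj_eval (- w) x))\<^sup>2 \<le> (2 * norm x)\<^sup>2"
      unfolding power_mult_distrib power2_eq_square[of 2] by linarith+
    show "norm (adj_eval w x) \<le> 2 * norm x" "norm (adj_eval (- w) x) \<le> 2 * norm x"
      using power2_le_imp_le[OF sq(1)] power2_le_imp_le[OF sq(2)] by simp_all
  qed
  have ge: "norm x \<le> norm (adj_eval w x) + norm (adj_eval (- w) x)" for x :: "'a adj"
  proof (rule power2_le_imp_le)
    have "0 \<le> norm (adj_eval w x) * norm (adj_eval (- w) x)"
      by simp
    moreover have "0 \<le> (norm x)\<^sup>2"
      by simp
    ultimately show "(norm x)\<^sup>2 \<le> (norm (adj_eval w x) + norm (adj_eval (- w) x))\<^sup>2"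
      using sum[of x] unfolding power2_sum mult.assoc by linarith
  qed simp
  show ?thesis
  proof
    assume ?L
    then obtain B where B: "norm (f n) \<le> B" for n
      unfolding bounded_iff by blast
    have "norm (adj_eval w (f n)) \<le> 2 * B" "norm (adj_eval (- w) (f n)) \<le> 2 * B" for n
      using le[of "f n"] B[of n] by linarith+
    then show "?P \<and> ?N"
      unfolding bounded_iff by blast
  next
    assume PN: "?P \<and> ?N"
    obtain B where B: "norm (adj_eval w (f n)) \<le> B" for n
      using conjunct1[OF PN] unfolding bounded_iff by blast
    obtain C where C: "norm (adj_eval (- w) (f n)) \<le> C" for n
      using conjunct2[OF PN] unfolding bounded_iff by blast
    have "norm (f n) \<le> B + C" for n
      using ge[of "f n"] B[of n] C[of n] by linarith
    then show ?L
      unfolding bounded_iff by blast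
  qed
qed

lemma Mandelbrot3_iff_adj_eval:
  assumes "w * w = -1" and isometry: "\<And>y. norm (w * y) = norm y"
  shows "c \<in> \<M>\<^sub>3 \<longleftrightarrow> adj_eval w c \<in> \<M>\<^sub>3 \<and> adj_eval (- w) c \<in> \<M>\<^sub>3"
  using bounded_iff_adj_eval[OF isometry, of "\<lambda>n. (quad_poly c ^^ n) 0"] assms(1)
  by (simp add: Mandelbrot3_def adj_eval_quad_poly_orbit)

lemma span_3_iff: "x \<in> span {u, v, w} \<longleftrightarrow> (\<exists>a b c. x = a *\<^sub>R u + b *\<^sub>R v + c *\<^sub>R w)"
proof -
  have "x - a *\<^sub>R u - b *\<^sub>R v - c *\<^sub>R w = 0 \<longleftrightarrow> x = a *\<^sub>R u + b *\<^sub>R v + c *\<^sub>R w" for a b c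
    by (simp add: algebra_simps)
  then show ?thesis
    by (simp add: span_breakdown_eq)
qed

text \<open>
  In \<open>\<j>\<^sub>2 = \<i>\<^sub>1 \<i>\<^sub>3\<close> the evaluations put \<open>-\<i>\<^sub>1\<close> and \<open>\<i>\<^sub>1\<close> for \<open>\<i>\<^sub>3\<close>, which gives \<open>1\<close> and
  \<open>-1\<close>; the other two units do not involve \<open>\<i>\<^sub>3\<close>.
\<close>

lemma adj_eval_hourglass:
  "adj_eval (Adj (- \<i>) 0) (a *\<^sub>R \<i>\<^sub>1 + b *\<^sub>R \<j>\<^sub>1 + c *\<^sub>R \<j>\<^sub>2) = a *\<^sub>R \<i>\<^sub>1 + b *\<^sub>R \<j>\<^sub>1 + of_real c"
  "adj_eval (Adj \<i> 0) (a *\<^sub>R \<i>\<^sub>1 + b *\<^sub>R \<j>\<^sub>1 + c *\<^sub>R \<j>\<^sub>2) = a *\<^sub>R \<i>\<^sub>1 + b *\<^sub>R \<j>\<^sub>1 - of_real c"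
  by (simp_all add: adj_eval_def tc_unit_defs adj_eq_iff of_real_def complex_eq_iff)

lemma hourglass_images_in_span:
  "a *\<^sub>R \<i>\<^sub>1 + b *\<^sub>R \<j>\<^sub>1 + of_real c \<in> span {1, \<i>\<^sub>1, \<j>\<^sub>1}"
  "a *\<^sub>R \<i>\<^sub>1 + b *\<^sub>R \<j>\<^sub>1 - of_real c \<in> span {1, \<i>\<^sub>1, \<j>\<^sub>1}"
  unfolding of_real_def by (intro span_add span_diff span_scale span_base; simp)+

text \<open>
  The point tested in a starred slice is an image of the given one and always lies in the span
  that occurs in \<open>\<T> 1 \<i>\<^sub>1 \<j>\<^sub>1\<close>, so the test only concerns \<open>\<M>\<^sub>3\<close>. In this form it is a condition on
  the point itself, and the conditions of the two slices can be conjoined.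
\<close>

lemma slice_star_pos_eq:
  "slice_star_pos = {x \<in> span {\<i>\<^sub>1, \<j>\<^sub>1, \<j>\<^sub>2}. adj_eval (Adj (- \<i>) 0) x \<in> \<M>\<^sub>3}"
proof -
  have iff: "a *\<^sub>R \<i>\<^sub>1 + b *\<^sub>R \<j>\<^sub>1 + of_real c \<in> \<T> 1 \<i>\<^sub>1 \<j>\<^sub>1 \<longleftrightarrow>
      adj_eval (Adj (- \<i>) 0) (a *\<^sub>R \<i>\<^sub>1 + b *\<^sub>R \<j>\<^sub>1 + c *\<^sub>R \<j>\<^sub>2) \<in> \<M>\<^sub>3" for a b c
    by (simp add: principal_slice_def hourglass_images_in_span adj_eval_hourglass)
  show ?thesis
    unfolding slice_star_pos_def iff span_3_iff by blast
qed

lemma slice_star_neg_eq: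
  "slice_star_neg = {x \<in> span {\<i>\<^sub>1, \<j>\<^sub>1, \<j>\<^sub>2}. adj_eval (Adj \<i> 0) x \<in> \<M>\<^sub>3}"
proof -
  have iff: "a *\<^sub>R \<i>\<^sub>1 + b *\<^sub>R \<j>\<^sub>1 - of_real c \<in> \<T> 1 \<i>\<^sub>1 \<j>\<^sub>1 \<longleftrightarrow>
      adj_eval (Adj \<i> 0) (a *\<^sub>R \<i>\<^sub>1 + b *\<^sub>R \<j>\<^sub>1 + c *\<^sub>R \<j>\<^sub>2) \<in> \<M>\<^sub>3" for a b c
    by (simp add: principal_slice_def hourglass_images_in_span adj_eval_hourglass)
  show ?thesis
    unfolding slice_star_neg_def iff span_3_iff by blast
qed

theorem proposition8:
  "\<T> \<i>\<^sub>1 \<j>\<^sub>1 \<j>\<^sub>2 = slice_star_pos \<inter> slice_star_neg"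
proof -
  have square: "Adj \<i> 0 * Adj \<i> 0 = (-1 :: complex adj)"
    by (simp add: adj_eq_iff)
  have isometry: "norm (Adj \<i> 0 * y) = norm y" for y :: "complex adj"
    by (simp add: norm_adj_def inner_adj_def inner_complex_def algebra_simps)
  have neg: "- Adj \<i> 0 = Adj (- \<i>) 0"
    by (simp add: adj_eq_iff)
  show ?thesis
  proof (rule set_eqI)
    fix c
    show "c \<in> \<T> \<i>\<^sub>1 \<j>\<^sub>1 \<j>\<^sub>2 \<longleftrightarrow> c \<in> slice_star_pos \<inter> slice_star_neg"
      using Mandelbrot3_iff_adj_eval[OF square isometry, of c]
      by (auto simp: principal_slice_def slice_star_pos_eq slice_star_neg_eq neg)
  qed
qed

end
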